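(* Let $\mu:\mathbb{D}\to\mathbb{B}$ be such that there exists a real constant $c$ satisfying $\|\mu\|_{L^\infty(\mathbb{D},\mathbb{B})}\le c<1$, and let $0<p<\infty$. Then $w=p^+w^++p^-w^-\in H^p_{Bel,\mu}(\mathbb{D},\mathbb{B})$ if and only if $(w^+)^*\in H^p_{Bel,(\mu^+)^*}(\mathbb{D})$ and $w^-\in H^p_{Bel,\mu^-}(\mathbb{D})$.
   Context: $\mathbb{D}$ is the unit disk in $\mathbb{C}$, $z=x+iy$; $z^*=x-iy$ denotes complex conjugation; $\frac{\partial}{\partial z}=\frac12(\partial_x-i\partial_y)$, $\frac{\partial}{\partial z^*}=\frac12(\partial_x+i\partial_y)$. The bicomplex numbers $\mathbb{B}=\{z_1+jz_2: z_1,z_2\in\mathbb{C}\}$ form the commutative $\mathbb{C}$-algebra with $j^2=-1$, $ij=ji$. Put $p^\pm=\frac12(1\pm ji)$. Every $w=z_1+jz_2\in\mathbb{B}$ is uniquely $w=p^+w^++p^-w^-$ with $w^\pm=z_1\mp iz_2\in\mathbb{C}$ (applied pointwise to functions). Norm: $\|w\|_{\mathbb{B}}=\sqrt{(|w^+|^2+|w^-|^2)/2}$, and $\|\mu\|_{L^\infty(\mathbb{D},\mathbb{B})}=\sup_{z\in\mathbb{D}}\|\mu(z)\|_{\mathbb{B}}$. The bicomplex operators are $\partial=\frac12(\partial_x-j\partial_y)$ and $\bar\partial=\frac12(\partial_x+j\partial_y)$. $H^p_{Bel,\mu}(\mathbb{D},\mathbb{B})$ is the set of $w:\mathbb{D}\to\mathbb{B}$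 that solve $\bar\partial w=\mu\,\partial w$ and satisfy $\left(\sup_{0<r<1}\frac{1}{2\pi}\int_0^{2\pi}\|w(re^{i\theta})\|_{\mathbb{B}}^p\,d\theta\right)^{1/p}<\infty$. For complex-valued $\nu\in L^\infty(\mathbb{D})$ for which there is a positive constant $c$ with $\|\nu\|_{L^\infty(\mathbb{D})}\le c<1$, $H^p_{Bel,\nu}(\mathbb{D})$ is the set of $v:\mathbb{D}\to\mathbb{C}$ that solve $\frac{\partial v}{\partial z^*}=\nu\frac{\partial v}{\partial z}$ and satisfy $\sup_{0<r<1}\int_0^{2\pi}|v(re^{i\theta})|^p\,d\theta<\infty$. *)

theory Defs
  imports "HOL-Analysis.Analysis"
begin

abbreviation unit_disk :: "complex set" where
  "unit_disk \<equiv> ball 0 1"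


subsection \<open>Bicomplex numbers\<close>

text \<open>\<open>Bicomplex a b\<close> is \<open>a + j b\<close>.\<close>

datatype bicomplex = Bicomplex (bc1: complex) (bc2: complex)

lemma bicomplex_eq_iff: "u = v \<longleftrightarrow> bc1 u = bc1 v \<and> bc2 u = bc2 v"
  by (cases u; cases v) simp

instantiation bicomplex :: comm_ring_1
begin

definition "0 = Bicomplex 0 0"
definition "1 = Bicomplex 1 0"
definition "u + v = Bicomplex (bc1 u + bc1 v) (bc2 u + bc2 v)"
definition "- u = Bicomplex (- bc1 u) (- bc2 u)"
definition "u - v = Bicomplex (bc1 u - bc1 v) (bc2 u - bc2 v)"
definition "u * v = Bicomplex (bc1 u * bc1 v - bc2 u * bc2 v) (bc1 u * bc2 v + bc2 u * bc1 v)"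

instance
  by standard
    (simp_all add: zero_bicomplex_def one_bicomplex_def plus_bicomplex_def uminus_bicomplex_def
      minus_bicomplex_def times_bicomplex_def algebra_simps)

end

definition bc_of_complex :: "complex \<Rightarrow> bicomplex" where
  "bc_of_complex a = Bicomplex a 0"

definition bc_j :: bicomplex where
  "bc_j = Bicomplex 0 1"

definition p_plus :: bicomplex where
  "p_plus = bc_of_complex (1/2) * (1 + bc_j * bc_of_complex \<i>)"

definition p_minus :: bicomplex where
  "p_minus = bc_of_complex (1/2) * (1 - bc_j * bc_of_complex \<i>)"

definition bc_plus :: "bicomplex \<Rightarrow> complex" where
  "bc_plus w = bc1 w - \<i> * bc2 w"

definition bc_minus :: "bicomplex \<Rightarrow> complex" where
  "bc_minus w = bc1 w + \<i> * bc2 w"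

lemmas bicomplex_defs = zero_bicomplex_def one_bicomplex_def plus_bicomplex_def
  uminus_bicomplex_def minus_bicomplex_def times_bicomplex_def bc_of_complex_def bc_j_def
  p_plus_def p_minus_def bc_plus_def bc_minus_def

lemma Bicomplex_conv: "Bicomplex a b = bc_of_complex a + bc_j * bc_of_complex b"
  by (simp add: bicomplex_defs)

lemma bc_j_square: "bc_j * bc_j = - 1"
  by (simp add: bicomplex_defs)

lemma bicomplex_idempotent_decomposition:
  "w = p_plus * bc_of_complex a + p_minus * bc_of_complex b \<longleftrightarrow> a = bc_plus w \<and> b = bc_minus w"
  by (cases w) (auto simp: bicomplex_defs complex_eq_iff field_simps)

definition bc_norm :: "bicomplex \<Rightarrow> real" where
  "bc_norm w = sqrt (((cmod (bc_plus w))\<^sup>2 + (cmod (bc_minus w))\<^sup>2) / 2)"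

definition bc_Linf_norm :: "(complex \<Rightarrow> bicomplex) \<Rightarrow> ereal" where
  "bc_Linf_norm \<mu> = (SUP z\<in>unit_disk. ereal (bc_norm (\<mu> z)))"


subsection \<open>Partial derivatives, classical and weak\<close>

definition partial_x :: "(complex \<Rightarrow> 'a::real_normed_vector) \<Rightarrow> complex \<Rightarrow> 'a" where
  "partial_x f z = frechet_derivative f (at z) 1"

definition partial_y :: "(complex \<Rightarrow> 'a::real_normed_vector) \<Rightarrow> complex \<Rightarrow> 'a" where
  "partial_y f z = frechet_derivative f (at z) \<i>"

text \<open>\<open>C_k k \<phi>\<close>: \<open>\<phi>\<close> is \<open>k\<close> times continuously real-differentiable on the plane.\<close>

primrec C_k :: "nat \<Rightarrow> (complex \<Rightarrow> real) \<Rightarrow> bool" where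
  "C_k 0 \<phi> \<longleftrightarrow> continuous_on UNIV \<phi>"
| "C_k (Suc k) \<phi> \<longleftrightarrow>
     (\<forall>z. \<phi> differentiable (at z)) \<and> C_k k (partial_x \<phi>) \<and> C_k k (partial_y \<phi>)"

definition test_function :: "(complex \<Rightarrow> real) \<Rightarrow> bool" where
  "test_function \<phi> \<longleftrightarrow> (\<forall>k. C_k k \<phi>) \<and>
     compact (closure {z. \<phi> z \<noteq> 0}) \<and> closure {z. \<phi> z \<noteq> 0} \<subseteq> unit_disk"

definition Lq_loc :: "real \<Rightarrow> (complex \<Rightarrow> complex) \<Rightarrow> bool" where
  "Lq_loc q f \<longleftrightarrow> f \<in> borel_measurable (lebesgue_on unit_disk) \<and>
     (\<forall>K. compact K \<and> K \<subseteq> unit_disk \<longrightarrow> integrable (lebesgue_on K) (\<lambda>z. cmod (f z) powr q))"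

text \<open>
  What it means to solve a first order equation on the disk with merely bounded coefficients
  depends on the class of solutions. \<open>Classical\<close>: real-differentiable functions satisfying
  the equation at every point. \<open>Sobolev q\<close>: functions in the local Sobolev space
  \<open>W^{1,q}\<close> whose distributional derivatives satisfy the equation almost everywhere
  (\<open>q = 1\<close> is the largest class of distributional solutions for which the products with the
  coefficient make sense; \<open>q = 2\<close> is the usual class for Beltrami equations).
\<close>

datatype solution_sense = Classical | Sobolev real

definition solution_senses :: "solution_sense set" where
  "solution_senses = {Classical} \<union> Sobolev ` {1..}"

text \<open>\<open>has_partials s f f\<^sub>x f\<^sub>y\<close>: in the sense \<open>s\<close>, the function \<open>f\<close> has the partial
  derivatives \<open>f\<^sub>x\<close> and \<open>f\<^sub>y\<close> on the disk.\<close>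

primrec has_partials ::
  "solution_sense \<Rightarrow> (complex \<Rightarrow> complex) \<Rightarrow> (complex \<Rightarrow> complex) \<Rightarrow> (complex \<Rightarrow> complex) \<Rightarrow> bool" where
  "has_partials Classical f fx fy \<longleftrightarrow>
     (\<forall>z\<in>unit_disk. f differentiable (at z) \<and> fx z = partial_x f z \<and> fy z = partial_y f z)"
| "has_partials (Sobolev q) f fx fy \<longleftrightarrow>
     Lq_loc q f \<and> Lq_loc q fx \<and> Lq_loc q fy \<and>
     (\<forall>\<phi>. test_function \<phi> \<longrightarrow>
        (LINT z|lebesgue_on unit_disk. f z * of_real (partial_x \<phi> z)) =
          - (LINT z|lebesgue_on unit_disk. fx z * of_real (\<phi> z)) \<and>
        (LINT z|lebesgue_on unit_disk. f z * of_real (partial_y \<phi> z)) =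
          - (LINT z|lebesgue_on unit_disk. fy z * of_real (\<phi> z)))"

primrec holds_on_disk :: "solution_sense \<Rightarrow> (complex \<Rightarrow> bool) \<Rightarrow> bool" where
  "holds_on_disk Classical P \<longleftrightarrow> (\<forall>z\<in>unit_disk. P z)"
| "holds_on_disk (Sobolev q) P \<longleftrightarrow> (AE z in lebesgue_on unit_disk. P z)"

text \<open>A derivative of \<open>z\<^sub>1 + j z\<^sub>2\<close> is taken in \<open>z\<^sub>1\<close> and \<open>z\<^sub>2\<close> separately.\<close>

definition bc_has_partials ::
  "solution_sense \<Rightarrow> (complex \<Rightarrow> bicomplex) \<Rightarrow> (complex \<Rightarrow> bicomplex) \<Rightarrow> (complex \<Rightarrow> bicomplex) \<Rightarrow> bool" where
  "bc_has_partials s w wx wy \<longleftrightarrow>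
     has_partials s (\<lambda>z. bc1 (w z)) (\<lambda>z. bc1 (wx z)) (\<lambda>z. bc1 (wy z)) \<and>
     has_partials s (\<lambda>z. bc2 (w z)) (\<lambda>z. bc2 (wx z)) (\<lambda>z. bc2 (wy z))"


subsection \<open>Beltrami equations\<close>

text \<open>The differential operators, as functions of the values of the two partial derivatives.\<close>

definition d_z :: "complex \<Rightarrow> complex \<Rightarrow> complex" where
  "d_z vx vy = (1/2) * (vx - \<i> * vy)"

definition d_zstar :: "complex \<Rightarrow> complex \<Rightarrow> complex" where
  "d_zstar vx vy = (1/2) * (vx + \<i> * vy)"

definition bc_d :: "bicomplex \<Rightarrow> bicomplex \<Rightarrow> bicomplex" where
  "bc_d wx wy = bc_of_complex (1/2) * (wx - bc_j * wy)"

definition bc_dbar :: "bicomplex \<Rightarrow> bicomplex \<Rightarrow> bicomplex" where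
  "bc_dbar wx wy = bc_of_complex (1/2) * (wx + bc_j * wy)"

definition beltrami_solution ::
  "solution_sense \<Rightarrow> (complex \<Rightarrow> complex) \<Rightarrow> (complex \<Rightarrow> complex) \<Rightarrow> bool" where
  "beltrami_solution s \<nu> v \<longleftrightarrow> (\<exists>vx vy. has_partials s v vx vy \<and>
     holds_on_disk s (\<lambda>z. d_zstar (vx z) (vy z) = \<nu> z * d_z (vx z) (vy z)))"

definition bc_beltrami_solution ::
  "solution_sense \<Rightarrow> (complex \<Rightarrow> bicomplex) \<Rightarrow> (complex \<Rightarrow> bicomplex) \<Rightarrow> bool" where
  "bc_beltrami_solution s \<mu> w \<longleftrightarrow> (\<exists>wx wy. bc_has_partials s w wx wy \<and>
     holds_on_disk s (\<lambda>z. bc_dbar (wx z) (wy z) = \<mu> z * bc_d (wx z) (wy z)))"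


subsection \<open>Hardy spaces\<close>

text \<open>Measurability on circles is what gives the integral means in the Hardy spaces a meaning; it
  has to be required because a Sobolev function is arbitrary on the null set formed by a circle.\<close>

definition circle_measurable :: "(complex \<Rightarrow> complex) \<Rightarrow> bool" where
  "circle_measurable v \<longleftrightarrow>
     (\<forall>r\<in>{0<..<1}. (\<lambda>\<theta>. v (rcis r \<theta>)) \<in> borel_measurable (lebesgue_on {0..2*pi}))"

definition ennreal_root :: "real \<Rightarrow> ennreal \<Rightarrow> ennreal" where
  "ennreal_root p x = (if x = \<infinity> then \<infinity> else ennreal (enn2real x powr (1/p)))"

definition bc_hardy_norm :: "real \<Rightarrow> (complex \<Rightarrow> bicomplex) \<Rightarrow> ennreal" where
  "bc_hardy_norm p w = ennreal_root p
     (SUP r\<in>{0<..<1}. ennreal (1 / (2*pi)) *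
        (\<integral>\<^sup>+\<theta>\<in>{0..2*pi}. ennreal (bc_norm (w (rcis r \<theta>)) powr p) \<partial>lebesgue))"

text \<open>The elements of both spaces are functions on the disk: all conditions ignore the values
  elsewhere. The complex space is defined for every coefficient \<open>\<nu>\<close>. The factor \<open>1/2\<close> in
  \<open>bc_norm\<close> is the reason: a coefficient \<open>\<mu>\<close> of norm at most \<open>c < 1\<close> only has
  components \<open>\<mu>\<^sup>+\<close> and \<open>\<mu>\<^sup>-\<close> bounded by \<open>sqrt 2 * c\<close>.\<close>

definition H_Bel :: "solution_sense \<Rightarrow> real \<Rightarrow> (complex \<Rightarrow> complex) \<Rightarrow> (complex \<Rightarrow> complex) set" where
  "H_Bel s p \<nu> = {v. beltrami_solution s \<nu> v \<and> circle_measurable v \<and>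
     (SUP r\<in>{0<..<1}. \<integral>\<^sup>+\<theta>\<in>{0..2*pi}. ennreal (cmod (v (rcis r \<theta>)) powr p) \<partial>lebesgue) < \<infinity>}"

definition bc_H_Bel ::
  "solution_sense \<Rightarrow> real \<Rightarrow> (complex \<Rightarrow> bicomplex) \<Rightarrow> (complex \<Rightarrow> bicomplex) set" where
  "bc_H_Bel s p \<mu> = {w. bc_beltrami_solution s \<mu> w \<and>
     circle_measurable (\<lambda>z. bc1 (w z)) \<and> circle_measurable (\<lambda>z. bc2 (w z)) \<and>
     bc_hardy_norm p w < \<infinity>}"

end

theory Submission
  imports Defs
begin

text \<open>
  The components \<open>w \<mapsto> w\<^sup>+\<close> and \<open>w \<mapsto> w\<^sup>-\<close> are ring homomorphisms sending \<open>j\<close> to \<open>- \<i>\<close> and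
  \<open>\<i>\<close>. The minus component of the bicomplex equation is therefore a complex Beltrami equation
  for \<open>w\<^sup>-\<close>, while the plus component has \<open>\<partial>/\<partial>z\<close> and \<open>\<partial>/\<partial>z\<^sup>*\<close> interchanged and becomes a Beltrami
  equation for the conjugate of \<open>w\<^sup>+\<close>. The growth conditions correspond because
  \<open>\<parallel>w\<parallel>\<^sup>p\<close> is comparable to \<open>|w\<^sup>+|\<^sup>p + |w\<^sup>-|\<^sup>p\<close>.
\<close>

subsection \<open>Algebra of the components\<close>

text \<open>Uniqueness of the coefficients in the idempotent decomposition: this is what turns one
  bicomplex equation into two independent complex ones.\<close>

lemma bc_eq_iff_components: "u = v \<longleftrightarrow> bc_plus u = bc_plus v \<and> bc_minus u = bc_minus v"
  by (metis bicomplex_idempotent_decomposition)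

lemma bc_plus_mult: "bc_plus (u * v) = bc_plus u * bc_plus v"
  by (simp add: bicomplex_defs algebra_simps)

lemma bc_minus_mult: "bc_minus (u * v) = bc_minus u * bc_minus v"
  by (simp add: bicomplex_defs algebra_simps)

lemma bc_plus_dbar: "bc_plus (bc_dbar a b) = d_z (bc_plus a) (bc_plus b)"
  by (simp add: bc_dbar_def d_z_def bicomplex_defs field_simps)

lemma bc_plus_d: "bc_plus (bc_d a b) = d_zstar (bc_plus a) (bc_plus b)"
  by (simp add: bc_d_def d_zstar_def bicomplex_defs field_simps)

lemma bc_minus_dbar: "bc_minus (bc_dbar a b) = d_zstar (bc_minus a) (bc_minus b)"
  by (simp add: bc_dbar_def d_zstar_def bicomplex_defs field_simps)

lemma bc_minus_d: "bc_minus (bc_d a b) = d_z (bc_minus a) (bc_minus b)"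
  by (simp add: bc_d_def d_z_def bicomplex_defs field_simps)

lemma cnj_d_z: "cnj (d_z a b) = d_zstar (cnj a) (cnj b)"
  by (simp add: d_z_def d_zstar_def)

lemma cnj_d_zstar: "cnj (d_zstar a b) = d_z (cnj a) (cnj b)"
  by (simp add: d_z_def d_zstar_def)

text \<open>In the plus component the two operators stand on the wrong sides. Conjugation is
  injective and swaps \<open>d_z\<close> with \<open>d_zstar\<close>, which restores the Beltrami
  form with conjugated coefficient. Only values at a point are involved, so this serves equations
  that hold everywhere as well as almost everywhere.\<close>

lemma bc_beltrami_iff_components:
  "bc_dbar a b = m * bc_d a b \<longleftrightarrow>
    d_zstar (cnj (bc_plus a)) (cnj (bc_plus b))
      = cnj (bc_plus m) * d_z (cnj (bc_plus a)) (cnj (bc_plus b)) \<and>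
    d_zstar (bc_minus a) (bc_minus b) = bc_minus m * d_z (bc_minus a) (bc_minus b)"
proof -
  have "d_z (bc_plus a) (bc_plus b) = bc_plus m * d_zstar (bc_plus a) (bc_plus b) \<longleftrightarrow>
      cnj (d_z (bc_plus a) (bc_plus b)) = cnj (bc_plus m * d_zstar (bc_plus a) (bc_plus b))"
    by (rule complex_cnj_cancel_iff[symmetric])
  then show ?thesis
    unfolding bc_eq_iff_components[of "bc_dbar a b"] bc_plus_mult bc_minus_mult
      bc_plus_dbar bc_plus_d bc_minus_dbar bc_minus_d complex_cnj_mult cnj_d_z cnj_d_zstar
    by simp
qed

text \<open>This and the next three formulas change coordinates in both directions. All have the
  literal shape \<open>a * x + b * y\<close>, even with a factor \<open>1\<close>, so that closure
  under linear combinations applies right after unfolding.\<close>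

lemma bc1_eq_components: "bc1 w = (1/2) * bc_plus w + (1/2) * bc_minus w"
  by (simp add: bicomplex_defs field_simps)

lemma bc2_eq_components: "bc2 w = (\<i>/2) * bc_plus w + (- \<i>/2) * bc_minus w"
  by (simp add: bicomplex_defs field_simps)

lemma bc_plus_eq_lincomb: "bc_plus w = 1 * bc1 w + (- \<i>) * bc2 w"
  by (simp add: bc_plus_def)

lemma bc_minus_eq_lincomb: "bc_minus w = 1 * bc1 w + \<i> * bc2 w"
  by (simp add: bc_minus_def)


subsection \<open>Linear combinations and conjugates of solutions\<close>

text \<open>Bounding a sum by twice its larger term replaces convexity, so exponents below 1 are
  covered too.\<close>

lemma norm_lincomb_powr_le:
  fixes a b x y :: "'a::real_normed_field"
  assumes "0 \<le> q"
  shows "norm (a * x + b * y) powr q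
    \<le> (2 * norm a) powr q * norm x powr q + (2 * norm b) powr q * norm y powr q"
proof -
  have "norm (a * x + b * y) \<le> norm a * norm x + norm b * norm y"
    by (metis norm_mult norm_triangle_ineq)
  also have "\<dots> \<le> 2 * max (norm a * norm x) (norm b * norm y)"
    by simp
  finally have "norm (a * x + b * y) powr q \<le> (2 * max (norm a * norm x) (norm b * norm y)) powr q"
    using assms by (intro powr_mono2) auto
  also have "\<dots> \<le> (2 * (norm a * norm x)) powr q + (2 * (norm b * norm y)) powr q"
    by (cases "norm a * norm x \<le> norm b * norm y") (auto simp: max_def)
  also have "\<dots> = (2 * norm a) powr q * norm x powr q + (2 * norm b) powr q * norm y powr q"
    by (simp add: powr_mult mult.assoc)
  finally show ?thesis .
qed

lemma Lq_loc_lincomb: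
  assumes q: "0 \<le> q" and f: "Lq_loc q f" and g: "Lq_loc q g"
  shows "Lq_loc q (\<lambda>z. a * f z + b * g z)"
  unfolding Lq_loc_def
proof (intro conjI allI impI)
  have [measurable]: "f \<in> borel_measurable (lebesgue_on unit_disk)"
    "g \<in> borel_measurable (lebesgue_on unit_disk)"
    using f g by (auto simp: Lq_loc_def)
  show meas: "(\<lambda>z. a * f z + b * g z) \<in> borel_measurable (lebesgue_on unit_disk)"
    by measurable
  fix K :: "complex set" assume K: "compact K \<and> K \<subseteq> unit_disk"
  have [measurable]: "(\<lambda>z. a * f z + b * g z) \<in> borel_measurable (lebesgue_on K)"
    using measurable_restrict_mono[OF meas] K by blast
  have "integrable (lebesgue_on K)
      (\<lambda>z. (2 * cmod a) powr q * cmod (f z) powr q + (2 * cmod b) powr q * cmod (g z) powr q)"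
    using f g K by (auto simp: Lq_loc_def)
  then show "integrable (lebesgue_on K) (\<lambda>z. cmod (a * f z + b * g z) powr q)"
  proof (rule Bochner_Integration.integrable_bound)
    show "AE z in lebesgue_on K. norm (cmod (a * f z + b * g z) powr q)
        \<le> norm ((2 * cmod a) powr q * cmod (f z) powr q + (2 * cmod b) powr q * cmod (g z) powr q)"
      using norm_lincomb_powr_le[OF q, of a _ b] by (intro AE_I2) simp
  qed measurable
qed

lemma Lq_loc_cnj: "Lq_loc q f \<Longrightarrow> Lq_loc q (\<lambda>z. cnj (f z))"
  unfolding Lq_loc_def
  using borel_measurable_continuous_on[of cnj f]
  by (auto intro: continuous_intros)

text \<open>The factor \<open>\<psi>\<close> confines the integrand to the compact set
  \<open>K\<close>, which has finite measure and on which \<open>\<psi>\<close> is bounded; there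
  local \<open>q\<close>-integrability gives integrability because \<open>1 \<le> q\<close>.\<close>

lemma Lq_loc_integrable_mult:
  fixes \<psi> :: "complex \<Rightarrow> real"
  assumes q: "1 \<le> q" and f: "Lq_loc q f" and cont: "continuous_on UNIV \<psi>"
    and K: "compact K" "K \<subseteq> unit_disk" and supp: "\<And>z. z \<notin> K \<Longrightarrow> \<psi> z = 0"
  shows "integrable (lebesgue_on unit_disk) (\<lambda>z. f z * of_real (\<psi> z))"
proof -
  have [measurable]: "f \<in> borel_measurable (lebesgue_on unit_disk)"
    using f by (auto simp: Lq_loc_def)
  have [measurable]: "\<psi> \<in> borel_measurable (lebesgue_on unit_disk)"
    using continuous_on_subset[OF cont] by (intro continuous_imp_measurable_on_sets_lebesgue) auto
  have "bounded (\<psi> ` K)"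
    using K(1) cont by (meson compact_continuous_image compact_imp_bounded continuous_on_subset subset_UNIV)
  then obtain M where M: "\<And>z. z \<in> K \<Longrightarrow> \<bar>\<psi> z\<bar> \<le> M" "0 < M"
    by (auto simp: bounded_pos)
  \<comment> \<open>The dominating function: \<open>M\<close> bounds \<open>\<psi>\<close> on
    \<open>K\<close>, and \<open>1 + cmod (f z) powr q\<close> bounds
    \<open>cmod (f z)\<close>.\<close>
  define g where "g z = indicat_real K z * (M * (1 + cmod (f z) powr q))" for z
  have Kl: "K \<in> lmeasurable"
    using K(1) by (simp add: lmeasurable_compact)
  have "integrable (lebesgue_on K) (\<lambda>z. M * (1 + cmod (f z) powr q))"
    using f K integrable_on_const[OF Kl, of "1::real"]
    by (intro integrable_mult_right Bochner_Integration.integrable_add)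
      (auto simp: Lq_loc_def intro!: finite_measure.integrable_const finite_measure_lebesgue_on[OF Kl])
  then have "integrable lebesgue g"
    using Kl by (simp add: integrable_restrict_space fmeasurableD g_def[abs_def] del: integrable_mult_right_iff integrable_mult_left_iff)
  \<comment> \<open>Cutting off at the disk does not change \<open>g\<close>, which vanishes outside
    \<open>K\<close>.\<close>
  then have "integrable lebesgue (\<lambda>z. indicat_real unit_disk z *\<^sub>R g z)"
    by (rule back_subst[where P = "integrable lebesgue"])
      (use K(2) in \<open>auto simp: g_def indicator_def fun_eq_iff\<close>)
  then have "integrable (lebesgue_on unit_disk) g"
    by (simp add: integrable_restrict_space)
  then show ?thesis
  proof (rule Bochner_Integration.integrable_bound)
    show "AE z in lebesgue_on unit_disk. norm (f z * of_real (\<psi> z)) \<le> norm (g z)"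
    proof (rule AE_I2)
      fix z
      show "norm (f z * of_real (\<psi> z)) \<le> norm (g z)"
      proof (cases "z \<in> K")
        case True
        \<comment> \<open>Either the modulus is at most 1, or raising it to a power
          \<open>q \<ge> 1\<close> does not decrease it.\<close>
        have "cmod (f z) \<le> 1 + cmod (f z) powr q"
        proof (cases "cmod (f z) \<le> 1")
          case True then show ?thesis
            by (simp add: add_increasing2)
        next
          case False then have "cmod (f z) powr 1 \<le> cmod (f z) powr q"
            using q by (intro powr_mono) auto
          then show ?thesis using False by simp
        qed
        then have "cmod (f z) * \<bar>\<psi> z\<bar> \<le> (1 + cmod (f z) powr q) * M"
          using M(1)[OF True] M(2) by (intro mult_mono) auto
        then show ?thesis
          using True M(2) by (simp add: g_def norm_mult mult.commute abs_mult)
      qed (simp add: supp)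
    qed
  qed measurable
qed

text \<open>The complement of the closed support is open and \<open>\<phi>\<close> is constantly 0
  on it. Hence one compact set serves for a test function and for its partial derivatives.\<close>

lemma partials_eq_0_outside_support:
  fixes \<phi> :: "complex \<Rightarrow> 'a::real_normed_vector"
  assumes "z \<notin> closure {z. \<phi> z \<noteq> 0}"
  shows "partial_x \<phi> z = 0" "partial_y \<phi> z = 0"
proof -
  let ?U = "- closure {z. \<phi> z \<noteq> 0}"
  have "(\<phi> has_derivative (\<lambda>_. 0)) (at z)"
  proof (rule has_derivative_transform_within_open[of "\<lambda>_. 0" _ z UNIV ?U])
    show "0 = \<phi> x" if "x \<in> ?U" for x
      using that closure_subset[of "{z. \<phi> z \<noteq> 0}"] by auto
  qed (use assms in auto)
  then have "frechet_derivative \<phi> (at z) = (\<lambda>_. 0)"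
    by (rule frechet_derivative_at[symmetric])
  then show "partial_x \<phi> z = 0" "partial_y \<phi> z = 0"
    by (simp_all add: partial_x_def partial_y_def)
qed

text \<open>These are the integrands in the weak derivative identities; their integrability allows
  the integrals of a linear combination to be split.\<close>

lemma Lq_loc_integrable_test_function:
  assumes q: "1 \<le> q" and f: "Lq_loc q f" and \<phi>: "test_function \<phi>"
  shows "integrable (lebesgue_on unit_disk) (\<lambda>z. f z * of_real (\<phi> z))"
    and "integrable (lebesgue_on unit_disk) (\<lambda>z. f z * of_real (partial_x \<phi> z))"
    and "integrable (lebesgue_on unit_disk) (\<lambda>z. f z * of_real (partial_y \<phi> z))"
proof -
  have K: "compact (closure {z. \<phi> z \<noteq> 0})" "closure {z. \<phi> z \<noteq> 0} \<subseteq> unit_disk"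
    using \<phi> by (auto simp: test_function_def)
  have "C_k 0 \<phi>" "C_k (Suc 0) \<phi>"
    using \<phi> unfolding test_function_def by blast+
  then have cont: "continuous_on UNIV \<phi>" "continuous_on UNIV (partial_x \<phi>)"
      "continuous_on UNIV (partial_y \<phi>)"
    by simp_all
  have "\<phi> z = 0" if "z \<notin> closure {z. \<phi> z \<noteq> 0}" for z
    using that closure_subset[of "{z. \<phi> z \<noteq> 0}"] by auto
  then show "integrable (lebesgue_on unit_disk) (\<lambda>z. f z * of_real (\<phi> z))"
    by (rule Lq_loc_integrable_mult[OF q f cont(1) K])
  show "integrable (lebesgue_on unit_disk) (\<lambda>z. f z * of_real (partial_x \<phi> z))"
    by (rule Lq_loc_integrable_mult[OF q f cont(2) K partials_eq_0_outside_support(1)])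
  show "integrable (lebesgue_on unit_disk) (\<lambda>z. f z * of_real (partial_y \<phi> z))"
    by (rule Lq_loc_integrable_mult[OF q f cont(3) K partials_eq_0_outside_support(2)])
qed

section \<open>Partial derivatives of linear combinations and conjugates\<close>

text \<open>Trades the choice operator inside \<open>frechet_derivative\<close> for an explicit
  derivative \<open>D\<close>, to which the calculus rules for \<open>has_derivative\<close>
  apply.\<close>

lemma has_partials_Classical_iff:
  "has_partials Classical f fx fy \<longleftrightarrow>
    (\<forall>z\<in>unit_disk. \<exists>D. (f has_derivative D) (at z) \<and> fx z = D 1 \<and> fy z = D \<i>)"
proof -
  have "f differentiable (at z) \<and> fx z = partial_x f z \<and> fy z = partial_y f z \<longleftrightarrow>
      (\<exists>D. (f has_derivative D) (at z) \<and> fx z = D 1 \<and> fy z = D \<i>)" for z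
    unfolding partial_x_def partial_y_def differentiable_def
    by (metis frechet_derivative_at)
  then show ?thesis by simp
qed

lemma has_partials_lincomb:
  assumes s: "s \<in> solution_senses"
    and f: "has_partials s f fx fy" and g: "has_partials s g gx gy"
  shows "has_partials s (\<lambda>z. a * f z + b * g z) (\<lambda>z. a * fx z + b * gx z) (\<lambda>z. a * fy z + b * gy z)"
proof (cases s)
  case Classical
  show ?thesis
    unfolding Classical has_partials_Classical_iff
  proof
    fix z assume z: "z \<in> unit_disk"
    obtain D E where
      D: "(f has_derivative D) (at z)" "fx z = D 1" "fy z = D \<i>" and
      E: "(g has_derivative E) (at z)" "gx z = E 1" "gy z = E \<i>"
      using f g z unfolding Classical has_partials_Classical_iff by blast
    have "((\<lambda>z. a * f z + b * g z) has_derivative (\<lambda>h. a * D h + b * E h)) (at z)"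
      by (intro has_derivative_add has_derivative_mult_right D E)
    then show "\<exists>F. ((\<lambda>z. a * f z + b * g z) has_derivative F) (at z) \<and>
        a * fx z + b * gx z = F 1 \<and> a * fy z + b * gy z = F \<i>"
      by (intro exI[of _ "\<lambda>h. a * D h + b * E h"] conjI) (simp_all add: D E)
  qed
next
  case (Sobolev q)
  then have q: "1 \<le> q"
    using s by (auto simp: solution_senses_def)
  have L: "Lq_loc q f" "Lq_loc q fx" "Lq_loc q fy" "Lq_loc q g" "Lq_loc q gx" "Lq_loc q gy"
    using f g by (auto simp: Sobolev)
  \<comment> \<open>Integrability of both summands matters: the integral of a nonintegrable function
    is 0 by convention, so additivity could fail.\<close>
  have int: "(LINT z|lebesgue_on unit_disk. (a * u z + b * v z) * of_real (\<psi> z)) =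
      a * (LINT z|lebesgue_on unit_disk. u z * of_real (\<psi> z)) +
      b * (LINT z|lebesgue_on unit_disk. v z * of_real (\<psi> z))"
    if "integrable (lebesgue_on unit_disk) (\<lambda>z. u z * of_real (\<psi> z))"
      "integrable (lebesgue_on unit_disk) (\<lambda>z. v z * of_real (\<psi> z))" for u v :: "complex \<Rightarrow> complex" and \<psi>
    using that by (simp add: distrib_right mult.assoc)
  note test = Lq_loc_integrable_test_function[OF q]
  show ?thesis
    unfolding Sobolev has_partials.simps
  proof (intro conjI allI impI)
    fix \<phi> assume \<phi>: "test_function \<phi>"
    show "(LINT z|lebesgue_on unit_disk. (a * f z + b * g z) * of_real (partial_x \<phi> z)) =
        - (LINT z|lebesgue_on unit_disk. (a * fx z + b * gx z) * of_real (\<phi> z))"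
      using f g \<phi> by (simp add: Sobolev int test[OF L(1) \<phi>] test[OF L(2) \<phi>] test[OF L(4) \<phi>] test[OF L(5) \<phi>])
    show "(LINT z|lebesgue_on unit_disk. (a * f z + b * g z) * of_real (partial_y \<phi> z)) =
        - (LINT z|lebesgue_on unit_disk. (a * fy z + b * gy z) * of_real (\<phi> z))"
      using f g \<phi> by (simp add: Sobolev int test[OF L(1) \<phi>] test[OF L(3) \<phi>] test[OF L(4) \<phi>] test[OF L(6) \<phi>])
  qed (use q L in \<open>auto intro!: Lq_loc_lincomb\<close>)
qed

lemma has_partials_cnj:
  assumes f: "has_partials s f fx fy"
  shows "has_partials s (\<lambda>z. cnj (f z)) (\<lambda>z. cnj (fx z)) (\<lambda>z. cnj (fy z))"
proof (cases s)
  case Classical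
  show ?thesis
    unfolding Classical has_partials_Classical_iff
  proof
    fix z assume z: "z \<in> unit_disk"
    obtain D where D: "(f has_derivative D) (at z)" "fx z = D 1" "fy z = D \<i>"
      using f z unfolding Classical has_partials_Classical_iff by blast
    have "((\<lambda>z. cnj (f z)) has_derivative (\<lambda>h. cnj (D h))) (at z)"
      by (rule bounded_linear.has_derivative[OF bounded_linear_cnj D(1)])
    then show "\<exists>F. ((\<lambda>z. cnj (f z)) has_derivative F) (at z) \<and> cnj (fx z) = F 1 \<and> cnj (fy z) = F \<i>"
      by (intro exI[of _ "\<lambda>h. cnj (D h)"] conjI) (simp_all add: D)
  qed
next
  case (Sobolev q)
  \<comment> \<open>The weight is real, and conjugation, being bounded linear and its own inverse,
    commutes with the integral even where the default value 0 is taken.\<close>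
  have int: "(LINT z|lebesgue_on unit_disk. cnj (u z) * of_real (\<psi> z)) =
      cnj (LINT z|lebesgue_on unit_disk. u z * of_real (\<psi> z))" for u and \<psi> :: "complex \<Rightarrow> real"
    using integral_bounded_linear'[OF bounded_linear_cnj bounded_linear_cnj,
      of "lebesgue_on unit_disk" "\<lambda>z. u z * of_real (\<psi> z)"] by simp
  show ?thesis
    using f by (auto simp: Sobolev int intro!: Lq_loc_cnj)
qed

section \<open>Splitting the bicomplex Beltrami equation\<close>

text \<open>The pairs \<open>bc1\<close>, \<open>bc2\<close> and \<open>bc_plus\<close>,
  \<open>bc_minus\<close> are invertible complex linear combinations of each other, and conjugating
  twice is the identity.\<close>

lemma bc_has_partials_iff_components:
  assumes s: "s \<in> solution_senses"
  shows "bc_has_partials s w wx wy \<longleftrightarrow>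
    has_partials s (\<lambda>z. cnj (bc_plus (w z))) (\<lambda>z. cnj (bc_plus (wx z))) (\<lambda>z. cnj (bc_plus (wy z))) \<and>
    has_partials s (\<lambda>z. bc_minus (w z)) (\<lambda>z. bc_minus (wx z)) (\<lambda>z. bc_minus (wy z))"
    (is "_ \<longleftrightarrow> ?plus \<and> ?minus")
proof (intro iffI conjI; (elim conjE)?)
  assume "bc_has_partials s w wx wy"
  then have *: "has_partials s (\<lambda>z. bc1 (w z)) (\<lambda>z. bc1 (wx z)) (\<lambda>z. bc1 (wy z))"
    "has_partials s (\<lambda>z. bc2 (w z)) (\<lambda>z. bc2 (wx z)) (\<lambda>z. bc2 (wy z))"
    by (auto simp: bc_has_partials_def)
  show ?plus
    unfolding bc_plus_eq_lincomb by (intro has_partials_cnj has_partials_lincomb s *)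
  show ?minus
    unfolding bc_minus_eq_lincomb by (intro has_partials_lincomb s *)
next
  assume ?plus and minus: ?minus
  then have plus: "has_partials s (\<lambda>z. bc_plus (w z)) (\<lambda>z. bc_plus (wx z)) (\<lambda>z. bc_plus (wy z))"
    using has_partials_cnj[OF \<open>?plus\<close>] by simp
  show "bc_has_partials s w wx wy"
    unfolding bc_has_partials_def bc1_eq_components bc2_eq_components
    by (intro conjI has_partials_lincomb s plus minus)
qed

lemma holds_on_disk_conj:
  "holds_on_disk s (\<lambda>z. P z \<and> Q z) \<longleftrightarrow> holds_on_disk s P \<and> holds_on_disk s Q"
  by (cases s) auto

lemma bc_beltrami_solution_iff_components:
  assumes s: "s \<in> solution_senses"
  shows "bc_beltrami_solution s \<mu> w \<longleftrightarrow>
    beltrami_solution s (\<lambda>z. cnj (bc_plus (\<mu> z))) (\<lambda>z. cnj (bc_plus (w z))) \<and>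
    beltrami_solution s (\<lambda>z. bc_minus (\<mu> z)) (\<lambda>z. bc_minus (w z))"
proof
  assume "bc_beltrami_solution s \<mu> w"
  then show "beltrami_solution s (\<lambda>z. cnj (bc_plus (\<mu> z))) (\<lambda>z. cnj (bc_plus (w z))) \<and>
      beltrami_solution s (\<lambda>z. bc_minus (\<mu> z)) (\<lambda>z. bc_minus (w z))"
    unfolding bc_beltrami_solution_def beltrami_solution_def bc_beltrami_iff_components
      holds_on_disk_conj bc_has_partials_iff_components[OF s]
    by blast
next
  assume "beltrami_solution s (\<lambda>z. cnj (bc_plus (\<mu> z))) (\<lambda>z. cnj (bc_plus (w z))) \<and>
      beltrami_solution s (\<lambda>z. bc_minus (\<mu> z)) (\<lambda>z. bc_minus (w z))"
  then obtain vx vy ux uy where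
    v: "has_partials s (\<lambda>z. cnj (bc_plus (w z))) vx vy"
      "holds_on_disk s (\<lambda>z. d_zstar (vx z) (vy z) = cnj (bc_plus (\<mu> z)) * d_z (vx z) (vy z))" and
    u: "has_partials s (\<lambda>z. bc_minus (w z)) ux uy"
      "holds_on_disk s (\<lambda>z. d_zstar (ux z) (uy z) = bc_minus (\<mu> z) * d_z (ux z) (uy z))"
    unfolding beltrami_solution_def by blast
  \<comment> \<open>The two complex solutions bring their own partial derivatives, which are glued
    by the idempotent decomposition; \<open>vx\<close> and \<open>vy\<close> are conjugated because
    they belong to the conjugate of the plus component.\<close>
  define wx where "wx z = p_plus * bc_of_complex (cnj (vx z)) + p_minus * bc_of_complex (ux z)" for z
  define wy where "wy z = p_plus * bc_of_complex (cnj (vy z)) + p_minus * bc_of_complex (uy z)" for z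
  have [simp]: "bc_plus (wx z) = cnj (vx z)" "bc_minus (wx z) = ux z"
    "bc_plus (wy z) = cnj (vy z)" "bc_minus (wy z) = uy z" for z
    using bicomplex_idempotent_decomposition wx_def wy_def by metis+
  have "bc_has_partials s w wx wy"
    using u v by (simp add: bc_has_partials_iff_components[OF s])
  moreover have "holds_on_disk s (\<lambda>z. bc_dbar (wx z) (wy z) = \<mu> z * bc_d (wx z) (wy z))"
    using u v by (simp add: bc_beltrami_iff_components holds_on_disk_conj)
  ultimately show "bc_beltrami_solution s \<mu> w"
    unfolding bc_beltrami_solution_def by blast
qed


subsection \<open>Integral means on circles\<close>

lemma circle_measurable_lincomb:
  "circle_measurable f \<Longrightarrow> circle_measurable g \<Longrightarrow> circle_measurable (\<lambda>z. a * f z + b * g z)"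
  unfolding circle_measurable_def by (auto intro!: borel_measurable_add borel_measurable_times)

lemma circle_measurable_cnj_iff: "circle_measurable (\<lambda>z. cnj (f z)) \<longleftrightarrow> circle_measurable f"
proof -
  have "circle_measurable (\<lambda>z. cnj (g z))" if "circle_measurable g" for g
    using that unfolding circle_measurable_def
    by (auto intro!: borel_measurable_continuous_on[of cnj] continuous_intros)
  from this[of f] this[of "\<lambda>z. cnj (f z)"] show ?thesis by auto
qed

lemma circle_measurable_iff_components:
  "circle_measurable (\<lambda>z. bc1 (w z)) \<and> circle_measurable (\<lambda>z. bc2 (w z)) \<longleftrightarrow>
    circle_measurable (\<lambda>z. bc_plus (w z)) \<and> circle_measurable (\<lambda>z. bc_minus (w z))"
proof (intro iffI; elim conjE)
  assume *: "circle_measurable (\<lambda>z. bc1 (w z))" "circle_measurable (\<lambda>z. bc2 (w z))"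
  show "circle_measurable (\<lambda>z. bc_plus (w z)) \<and> circle_measurable (\<lambda>z. bc_minus (w z))"
    unfolding bc_plus_eq_lincomb bc_minus_eq_lincomb by (intro conjI circle_measurable_lincomb *)
next
  assume *: "circle_measurable (\<lambda>z. bc_plus (w z))" "circle_measurable (\<lambda>z. bc_minus (w z))"
  show "circle_measurable (\<lambda>z. bc1 (w z)) \<and> circle_measurable (\<lambda>z. bc2 (w z))"
    unfolding bc1_eq_components bc2_eq_components by (intro conjI circle_measurable_lincomb *)
qed

section \<open>Comparison of the bicomplex norm with the component moduli\<close>

text \<open>The constant \<open>sqrt 2\<close> compensates the factor 1/2 under the root in
  \<open>bc_norm\<close>.\<close>

lemma cmod_components_le:
  "cmod (bc_plus w) \<le> sqrt 2 * bc_norm w" "cmod (bc_minus w) \<le> sqrt 2 * bc_norm w"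
  by (auto simp: bc_norm_def simp flip: real_sqrt_mult intro!: real_le_rsqrt)

lemma bc_norm_nonneg: "0 \<le> bc_norm w"
  by (simp add: bc_norm_def)

text \<open>A quadratic mean of two numbers never exceeds the larger one.\<close>

lemma bc_norm_le: "bc_norm w \<le> max (cmod (bc_plus w)) (cmod (bc_minus w))"
proof -
  define m where "m = max (cmod (bc_plus w)) (cmod (bc_minus w))"
  have m: "cmod (bc_plus w) \<le> m" "cmod (bc_minus w) \<le> m" "0 \<le> m"
    by (auto simp: m_def le_max_iff_disj)
  then have "(cmod (bc_plus w))\<^sup>2 + (cmod (bc_minus w))\<^sup>2 \<le> m\<^sup>2 + m\<^sup>2"
    by (intro add_mono power_mono) auto
  then have "((cmod (bc_plus w))\<^sup>2 + (cmod (bc_minus w))\<^sup>2) / 2 \<le> m\<^sup>2"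
    by simp
  then show ?thesis
    unfolding bc_norm_def m_def[symmetric] by (rule real_le_lsqrt[OF m(3)])
qed

text \<open>The power of the maximum is one of the two summands, so the constant is 1 for every
  exponent, including those below 1.\<close>

lemma bc_norm_powr_le:
  assumes "0 \<le> p"
  shows "bc_norm w powr p \<le> cmod (bc_plus w) powr p + cmod (bc_minus w) powr p"
proof -
  have "bc_norm w powr p \<le> max (cmod (bc_plus w)) (cmod (bc_minus w)) powr p"
    using assms bc_norm_le bc_norm_nonneg by (intro powr_mono2) auto
  also have "\<dots> \<le> cmod (bc_plus w) powr p + cmod (bc_minus w) powr p"
    by (auto simp: max_def)
  finally show ?thesis .
qed

lemma cmod_components_powr_le:
  assumes "0 \<le> p"
  shows "cmod (bc_plus w) powr p \<le> sqrt 2 powr p * bc_norm w powr p"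
    and "cmod (bc_minus w) powr p \<le> sqrt 2 powr p * bc_norm w powr p"
  using powr_mono2[OF assms _ cmod_components_le(1)[of w]]
    powr_mono2[OF assms _ cmod_components_le(2)[of w]]
  by (simp_all add: powr_mult bc_norm_nonneg)

section \<open>Finiteness of the Hardy means\<close>

text \<open>Measurability is given only on \<open>S\<close>, so the constant is pulled out over
  \<open>lebesgue_on S\<close>.\<close>

lemma nn_integral_le_cmult:
  assumes "\<And>x. f x \<le> C * g x" "0 \<le> C" "\<And>x. 0 \<le> g x"
    and [measurable]: "g \<in> borel_measurable (lebesgue_on S)" and S: "S \<in> sets lebesgue"
  shows "(\<integral>\<^sup>+x\<in>S. ennreal (f x) \<partial>lebesgue) \<le> ennreal C * (\<integral>\<^sup>+x\<in>S. ennreal (g x) \<partial>lebesgue)"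
proof -
  have "(\<integral>\<^sup>+x. ennreal (f x) \<partial>lebesgue_on S) \<le> (\<integral>\<^sup>+x. ennreal C * ennreal (g x) \<partial>lebesgue_on S)"
    using assms by (intro nn_integral_mono) (simp flip: ennreal_mult)
  also have "\<dots> = ennreal C * (\<integral>\<^sup>+x. ennreal (g x) \<partial>lebesgue_on S)"
    by (rule nn_integral_cmult) measurable
  finally show ?thesis
    using S by (simp add: nn_integral_restrict_space)
qed

text \<open>The factor \<open>1 / (2*pi)\<close> is positive and finite, and
  \<open>ennreal_root\<close> is infinite exactly at infinity.\<close>

lemma bc_hardy_norm_finite_iff:
  "bc_hardy_norm p w < \<infinity> \<longleftrightarrow>
    (SUP r\<in>{0<..<1}. \<integral>\<^sup>+\<theta>\<in>{0..2*pi}. ennreal (bc_norm (w (rcis r \<theta>)) powr p) \<partial>lebesgue) < \<infinity>"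
  unfolding bc_hardy_norm_def ennreal_root_def
  by (subst SUP_mult_left_ennreal[symmetric]) (auto simp: less_top[symmetric] ennreal_mult_eq_top_iff)

lemma hardy_finite_iff_components:
  assumes p: "0 \<le> p"
    and meas: "circle_measurable (\<lambda>z. bc_plus (w z))" "circle_measurable (\<lambda>z. bc_minus (w z))"
  shows "bc_hardy_norm p w < \<infinity> \<longleftrightarrow>
    (SUP r\<in>{0<..<1}. \<integral>\<^sup>+\<theta>\<in>{0..2*pi}. ennreal (cmod (bc_plus (w (rcis r \<theta>))) powr p) \<partial>lebesgue) < \<infinity> \<and>
    (SUP r\<in>{0<..<1}. \<integral>\<^sup>+\<theta>\<in>{0..2*pi}. ennreal (cmod (bc_minus (w (rcis r \<theta>))) powr p) \<partial>lebesgue) < \<infinity>"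
proof -
  let ?I = "{0<..<1::real}" and ?C = "ennreal (sqrt 2 powr p)"
  define B where "B r = (\<integral>\<^sup>+\<theta>\<in>{0..2*pi}. ennreal (bc_norm (w (rcis r \<theta>)) powr p) \<partial>lebesgue)" for r
  define P where "P r = (\<integral>\<^sup>+\<theta>\<in>{0..2*pi}. ennreal (cmod (bc_plus (w (rcis r \<theta>))) powr p) \<partial>lebesgue)" for r
  define M where "M r = (\<integral>\<^sup>+\<theta>\<in>{0..2*pi}. ennreal (cmod (bc_minus (w (rcis r \<theta>))) powr p) \<partial>lebesgue)" for r
  \<comment> \<open>The constants do not depend on \<open>r\<close>, so these circlewise bounds
    survive the supremum.\<close>
  have *: "P r \<le> ?C * B r" "M r \<le> ?C * B r" "B r \<le> P r + M r" if r: "r \<in> ?I" for r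
  proof -
    have m[measurable]: "(\<lambda>\<theta>. bc_plus (w (rcis r \<theta>))) \<in> borel_measurable (lebesgue_on {0..2*pi})"
      "(\<lambda>\<theta>. bc_minus (w (rcis r \<theta>))) \<in> borel_measurable (lebesgue_on {0..2*pi})"
      using meas r by (auto simp: circle_measurable_def)
    have [measurable]: "(\<lambda>\<theta>. bc_norm (w (rcis r \<theta>)) powr p) \<in> borel_measurable (lebesgue_on {0..2*pi})"
      unfolding bc_norm_def by measurable
    show "P r \<le> ?C * B r" "M r \<le> ?C * B r"
      unfolding P_def M_def B_def
      by (intro nn_integral_le_cmult cmod_components_powr_le p; simp)+
    have "(\<integral>\<^sup>+\<theta>. ennreal (bc_norm (w (rcis r \<theta>)) powr p) \<partial>lebesgue_on {0..2*pi}) \<le>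
        (\<integral>\<^sup>+\<theta>. ennreal (cmod (bc_plus (w (rcis r \<theta>))) powr p) +
          ennreal (cmod (bc_minus (w (rcis r \<theta>))) powr p) \<partial>lebesgue_on {0..2*pi})"
      by (intro nn_integral_mono) (simp add: bc_norm_powr_le p flip: ennreal_plus)
    also have "\<dots> = (\<integral>\<^sup>+\<theta>. ennreal (cmod (bc_plus (w (rcis r \<theta>))) powr p) \<partial>lebesgue_on {0..2*pi}) +
        (\<integral>\<^sup>+\<theta>. ennreal (cmod (bc_minus (w (rcis r \<theta>))) powr p) \<partial>lebesgue_on {0..2*pi})"
      by (rule nn_integral_add) measurable
    finally show "B r \<le> P r + M r"
      by (simp add: nn_integral_restrict_space B_def P_def M_def)
  qed
  have "(SUP r\<in>?I. B r) < \<infinity> \<longleftrightarrow> (SUP r\<in>?I. P r) < \<infinity> \<and> (SUP r\<in>?I. M r) < \<infinity>"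
  proof
    assume fin: "(SUP r\<in>?I. B r) < \<infinity>"
    have "X r \<le> ?C * (SUP r\<in>?I. B r)" if "r \<in> ?I" "X r \<le> ?C * B r" for X and r
      using that by (meson SUP_upper mult_left_mono order_trans zero_le)
    then have "(SUP r\<in>?I. P r) \<le> ?C * (SUP r\<in>?I. B r)" "(SUP r\<in>?I. M r) \<le> ?C * (SUP r\<in>?I. B r)"
      using * by (auto intro!: SUP_least)
    moreover have "?C * (SUP r\<in>?I. B r) < \<infinity>"
      using fin by (simp add: ennreal_mult_less_top)
    ultimately show "(SUP r\<in>?I. P r) < \<infinity> \<and> (SUP r\<in>?I. M r) < \<infinity>"
      by (meson le_less_trans)
  next
    assume fin: "(SUP r\<in>?I. P r) < \<infinity> \<and> (SUP r\<in>?I. M r) < \<infinity>"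
    have "(SUP r\<in>?I. B r) \<le> (SUP r\<in>?I. P r) + (SUP r\<in>?I. M r)"
      using * by (intro SUP_least) (meson SUP_upper add_mono order_trans)
    also have "\<dots> < \<infinity>"
      using fin by simp
    finally show "(SUP r\<in>?I. B r) < \<infinity>" .
  qed
  then show ?thesis
    unfolding bc_hardy_norm_finite_iff B_def P_def M_def .
qed

theorem theorem3p4:
  fixes \<mu> w :: "complex \<Rightarrow> bicomplex" and c p :: real and s :: solution_sense
  assumes "bc_Linf_norm \<mu> \<le> ereal c" and "c < 1"
    and "0 < p"
    and "s \<in> solution_senses"
  shows "w \<in> bc_H_Bel s p \<mu> \<longleftrightarrow>
    (\<lambda>z. cnj (bc_plus (w z))) \<in> H_Bel s p (\<lambda>z. cnj (bc_plus (\<mu> z))) \<and>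
    (\<lambda>z. bc_minus (w z)) \<in> H_Bel s p (\<lambda>z. bc_minus (\<mu> z))"
proof -
  let ?meas = "circle_measurable (\<lambda>z. bc_plus (w z)) \<and> circle_measurable (\<lambda>z. bc_minus (w z))"
  \<comment> \<open>\<open>?meas\<close> stays on both sides because \<open>conj_cong\<close> then
    supplies it as the hypothesis of the growth equivalence.\<close>
  have "?meas \<and> bc_hardy_norm p w < \<infinity> \<longleftrightarrow> ?meas \<and>
    (SUP r\<in>{0<..<1}. \<integral>\<^sup>+\<theta>\<in>{0..2*pi}. ennreal (cmod (bc_plus (w (rcis r \<theta>))) powr p) \<partial>lebesgue) < \<infinity> \<and>
    (SUP r\<in>{0<..<1}. \<integral>\<^sup>+\<theta>\<in>{0..2*pi}. ennreal (cmod (bc_minus (w (rcis r \<theta>))) powr p) \<partial>lebesgue) < \<infinity>"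
    by (intro conj_cong refl hardy_finite_iff_components) (use \<open>0 < p\<close> in auto)
  \<comment> \<open>Conjugation affects neither moduli nor circle measurability. Reassociating
    groups the conditions on \<open>bc1\<close> and \<open>bc2\<close> into the pair that
    \<open>circle_measurable_iff_components\<close> rewrites.\<close>
  then show ?thesis
    unfolding bc_H_Bel_def H_Bel_def mem_Collect_eq
      bc_beltrami_solution_iff_components[OF \<open>s \<in> solution_senses\<close>]
      circle_measurable_cnj_iff complex_mod_cnj
      conj_assoc[of "circle_measurable (\<lambda>z. bc1 (w z))", symmetric]
    by (simp only: circle_measurable_iff_components conj_ac)
qed

end
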